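(* Let $\pi\colon(\Gamma,\alpha)\to(\Gamma_B,\alpha_B)$ be a GKM fiber bundle with $\Gamma_B$ connected, $\Gamma=(V,E)$, $\Gamma_B=(V_B,E_B)$. Let $p\in V_B$ and let $f\in(K_{\alpha_p}(\Gamma_p))^{\mathrm{Hol}}$ be an invariant class on the fiber $(\Gamma_p,\alpha_p)$. For $q\in V_B$ let $f_q=\Upsilon_\gamma^*(f)\in K_{\alpha_q}(\Gamma_q)$, where $\gamma$ is any path in $\Gamma_B$ from $q$ to $p$ (by invariance of $f$, $f_q$ does not depend on the choice of $\gamma$). Let $c\in\mathrm{Maps}(V,R(T))$ be the map defined by $c(q')=f_{\pi(q')}(q')$ for every $q'\in V$. Then $c\in K_\alpha(\Gamma)$.
   Context: Let $T$ be a compact torus, $\mathfrak t^*$ the dual of its Lie algebra, $\mathbb Z_T^*\subset\mathfrak t^*$ its weight lattice. $R(T)$ is the representation (character) ring of $T$, identified with the group ring of $\mathbb Z_T^*$: finite sums $\sum_k m_k e^{2\pi\sqrt{-1}\alpha_k}$ with $m_k\in\mathbb Z$, $\alpha_k\in\mathbb Z_T^*$. Graphs. $\Gamma=(V,E)$ is a regular ($d$-valent) graph with vertex set $V$ and set $E$ of oriented edges $e=(p,q)$ ($p$ initial, $q$ terminal vertex); each edge $e=(p,q)$ has a reverse $\overline e=(q,p)\in E$. $E_p$ is the set of edges with initial vertex $p$. A connection on $\Gamma$ is a family $\nabla=\{\nabla_e\}_{e\in E}$ of bijections $\nabla_e\colon E_p\to E_q$ (for $e=(p,q)$) with $\nabla_e(e)=\overline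 e$ and $\nabla_{\overline e}=\nabla_e^{-1}$. Integral GKM graph. An integral axial function on $\Gamma$ is a map $\alpha\colon E\to\mathbb Z_T^*$ such that for some connection $\nabla$ on $\Gamma$: (i) $\alpha(\overline e)=-\alpha(e)$; (ii) for each $p\in V$ the vectors $\alpha(e)$, $e\in E_p$, are pairwise linearly independent; (iii) for each $e=(p,q)\in E$ and $e'\in E_p$, $\alpha(\nabla_e(e'))-\alpha(e')$ is an integer multiple of $\alpha(e)$. An (integral) GKM graph is a pair $(\Gamma,\alpha)$ of this kind. $K$-ring. $K_\alpha(\Gamma)$ is the subring of $\mathrm{Maps}(V,R(T))$ (pointwise operations) consisting of the $f$ such that for every $e=(p,q)\in E$, $f(p)-f(q)\in(1-e^{2\pi\sqrt{-1}\alpha(e)})R(T)$. Isomorphism of GKM graphs $(\Gamma_1,\alpha_1)$ (with values in a lattice in $\mathfrak t_1^*$) and $(\Gamma_2,\alpha_2)$ (with values in a lattice in $\mathfrak t_2^*$): a pair $(\Phi,\Psi)$ with $\Phi\colon\Gamma_1\to\Gamma_2$ a graph isomorphism and $\Psi\colon\mathfrak t_1^*\to\mathfrak t_2^*$ a linear isomorphism mapping the first lattice onto the second, such that $\alpha_2(\Phi(p),\Phi(q))=\Psi(\alpha_1(p,q))$ for every edge $(p,q)$ of $\Gamma_1$. GKM fiber bundle. Let $(\Gamma,\alpha)$, $(\Gamma_B,\alpha_B)$ be GKM graphs with axial functions in the same lattice $\mathbb Z_T^*$, with connections $\nabla$, $\nabla_B$ with which $\alpha$, $\alpha_B$ are compatible.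 Let $\pi\colon\Gamma\to\Gamma_B$ be a surjective morphism of graphs: $\pi$ maps $V$ onto $V_B$, and for every edge $e=(p,q)$ of $\Gamma$ either $\pi(p)=\pi(q)$ ($e$ is vertical) or $(\pi(p),\pi(q))\in E_B$ ($e$ is horizontal). Let $H_p\subset E_p$ be the set of horizontal edges at $p$, and $(d\pi)_p\colon H_p\to (E_B)_{\pi(p)}$ the induced map. $\pi$ is a GKM fiber bundle if: 1. for all $p\in V$, $(d\pi)_p$ is a bijection and $\alpha_B((d\pi)_p(e))=\alpha(e)$ for all $e\in H_p$; 2. $\nabla$ moves horizontal edges to horizontal edges and vertical edges to vertical edges, and its restriction to horizontal edges is compatible (via $d\pi$) with $\nabla_B$; 3. for $p\in V_B$ let $V_p=\pi^{-1}(p)$ and $\Gamma_p$ the induced subgraph of $\Gamma$ on $V_p$; for an edge $(p,q)$ of $\Gamma_B$ let $\Phi_{p,q}\colon V_p\to V_q$ be the bijection with $\Phi_{p,q}(p')=q'$ iff $(p',q')$ is the horizontal edge at $p'$ with $(d\pi)_{p'}(p',q')=(p,q)$ (the lift of $(p,q)$ at $p'$). Then $\Phi_{p,q}\colon\Gamma_p\to\Gamma_q$ is a graph isomorphism, and for each lift $(p_1,q_1)$ of $(p,q)$ and each edge $(p_1,p_2)$ of $\Gamma_p$, $\nabla_{(p_1,q_1)}(p_1,p_2)=(q_1,q_2)$ where $q_2=\Phi_{p,q}(p_2)$; 4. let $\alpha_p$ be the restriction of $\alpha$ to edges of $\Gamma_p$ and $\mathfrak v_p^*\subset\mathfrak t^*$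 the subspace spanned by its values; for every edge $(p,q)$ of $\Gamma_B$ there is an isomorphism of GKM graphs $\Upsilon_{p,q}=(\Phi_{p,q},\Psi_{p,q})\colon(\Gamma_p,\alpha_p)\to(\Gamma_q,\alpha_q)$, with $\Psi_{p,q}\colon\mathfrak v_p^*\to\mathfrak v_q^*$ mapping $\mathfrak v_p^*\cap\mathbb Z_T^*$ onto $\mathfrak v_q^*\cap\mathbb Z_T^*$ (note $\Psi_{p,q}$ is determined by $\Phi_{p,q}$); 5. for every edge $(p,q)$ of $\Gamma_B$ there is a function $m\colon\mathfrak v_p^*\cap\mathbb Z_T^*\to\mathbb Z$ such that $\Psi_{p,q}(x)=x+m(x)\alpha_B(p,q)$. Fiber $K$-rings and holonomy. For $p\in V_B$ let $R_p\subset R(T)$ be the subring of finite sums $\sum_k n_ke^{2\pi\sqrt{-1}\alpha_k}$ with $n_k\in\mathbb Z$, $\alpha_k\in\mathfrak v_p^*\cap\mathbb Z_T^*$. $K_{\alpha_p}(\Gamma_p)$ is the ring of maps $f\colon V_p\to R_p$ with $f(p')-f(p'')\in(1-e^{2\pi\sqrt{-1}\alpha_p(p',p'')})R_p$ for every edge $(p',p'')$ of $\Gamma_p$. An isomorphism $\Upsilon=(\Phi,\Psi)\colon(\Gamma_p,\alpha_p)\to(\Gamma_q,\alpha_q)$ extends $\Psi$ to a ring isomorphism $R_p\to R_q$ by $\Psi(e^{2\pi\sqrt{-1}x})=e^{2\pi\sqrt{-1}\Psi(x)}$ and induces a ring isomorphism $\Upsilon^*\colon K_{\alpha_q}(\Gamma_q)\to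 K_{\alpha_p}(\Gamma_p)$, $\Upsilon^*(f)(p')=\Psi^{-1}(f(\Phi(p')))$. For a path $\gamma\colon p_0\to p_1\to\cdots\to p_m$ in $\Gamma_B$ put $\Upsilon_\gamma=\Upsilon_{p_{m-1},p_m}\circ\cdots\circ\Upsilon_{p_0,p_1}\colon(\Gamma_{p_0},\alpha_{p_0})\to(\Gamma_{p_m},\alpha_{p_m})$. The holonomy group $\mathrm{Hol}_\pi(\Gamma_p)$ is the group of all $\Upsilon_\gamma$ for loops $\gamma$ in $\Gamma_B$ starting and ending at $p$. A class $f\in K_{\alpha_p}(\Gamma_p)$ is invariant if $\Upsilon_\gamma^*(f)=f$ for all $\Upsilon_\gamma\in\mathrm{Hol}_\pi(\Gamma_p)$; $(K_{\alpha_p}(\Gamma_p))^{\mathrm{Hol}}$ is the subring of invariant classes. *)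

theory Defs
  imports Complex_Main "HOL-Library.FuncSet" "HOL-Library.Poly_Mapping" "Graph_Theory.Graph_Theory"
begin

section \<open>Weight lattice and representation ring\<close>

text \<open>The dual \<open>\<tt>*\<close> of the Lie algebra of a compact torus is modelled by a real vector space; the
  weight lattice is a full lattice in it (so the space is finite-dimensional).\<close>

definition weight_lattice :: "'t::real_vector set \<Rightarrow> bool" where
  "weight_lattice \<Lambda> \<longleftrightarrow> (\<exists>B. finite B \<and> independent B \<and> span B = UNIV \<and>
     \<Lambda> = range (\<lambda>n :: 't \<Rightarrow> int. \<Sum>b\<in>B. of_int (n b) *\<^sub>R b))"

text \<open>The type \<open>'t \<Rightarrow>\<^sub>0 int\<close> with the convolution product is the group ring of the additive group
  \<open>'t\<close>; its element \<open>frag_of \<alpha>\<close> plays the role of \<open>exp (2 \<pi> \<i> \<alpha>)\<close>.  The representation ring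
  is \<open>rep_ring \<Lambda>\<close>, and the ring \<open>R\<^sub>p\<close> of a fiber is \<open>rep_ring (\<vv>\<^sub>p* \<inter> \<Lambda>)\<close>.\<close>

definition rep_ring :: "'t::real_vector set \<Rightarrow> ('t \<Rightarrow>\<^sub>0 int) set" where
  "rep_ring L = {r. Poly_Mapping.keys r \<subseteq> L}"

section \<open>GKM graphs\<close>

text \<open>No finiteness of the vertex set is imposed; only the valence is finite.\<close>

locale gkm_graph = pair_bidirected_digraph G for G :: "'v pair_pre_digraph" +
  fixes \<Lambda> :: "'t::real_vector set"
    and \<alpha> :: "'v \<times> 'v \<Rightarrow> 't"
    and conn :: "'v \<times> 'v \<Rightarrow> 'v \<times> 'v \<Rightarrow> 'v \<times> 'v"
  assumes regular:
      "\<exists>d. \<forall>p\<in>pverts G. finite (out_arcs (with_proj G) p) \<and> out_degree (with_proj G) p = d"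
    and connection_bij: "(p, q) \<in> parcs G \<Longrightarrow>
      bij_betw (conn (p, q)) (out_arcs (with_proj G) p) (out_arcs (with_proj G) q)"
    and connection_edge: "(p, q) \<in> parcs G \<Longrightarrow> conn (p, q) (p, q) = (q, p)"
    and connection_inverse: "\<lbrakk>(p, q) \<in> parcs G; e \<in> out_arcs (with_proj G) p\<rbrakk> \<Longrightarrow>
      conn (q, p) (conn (p, q) e) = e"
    and axial_lattice: "e \<in> parcs G \<Longrightarrow> \<alpha> e \<in> \<Lambda>"
    and axial_reverse: "(p, q) \<in> parcs G \<Longrightarrow> \<alpha> (q, p) = - \<alpha> (p, q)"
    and axial_independent: "\<lbrakk>p \<in> pverts G; e \<in> out_arcs (with_proj G) p;
      e' \<in> out_arcs (with_proj G) p; e \<noteq> e'; a *\<^sub>R \<alpha> e + b *\<^sub>R \<alpha> e' = 0\<rbrakk> \<Longrightarrow> a = 0 \<and> b = 0"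
    and axial_connection: "\<lbrakk>(p, q) \<in> parcs G; e \<in> out_arcs (with_proj G) p\<rbrakk> \<Longrightarrow>
      \<exists>k :: int. \<alpha> (conn (p, q) e) - \<alpha> e = of_int k *\<^sub>R \<alpha> (p, q)"

text \<open>With \<open>L = \<Lambda>\<close> this is \<open>K\<^sub>\<alpha>(\<Gamma>)\<close>; with \<open>L = \<vv>\<^sub>p* \<inter> \<Lambda>\<close> and the fiber graph it is the
  \<open>K\<close>-ring of the fiber.  Maps are extensional, so equality of classes is equality of functions.\<close>

definition K_ring ::
  "'t::real_vector set \<Rightarrow> 'v pair_pre_digraph \<Rightarrow> ('v \<times> 'v \<Rightarrow> 't) \<Rightarrow> ('v \<Rightarrow> 't \<Rightarrow>\<^sub>0 int) set" where
  "K_ring L G \<alpha> = {f \<in> pverts G \<rightarrow>\<^sub>E rep_ring L.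
     \<forall>(p, q) \<in> parcs G. \<exists>r \<in> rep_ring L. f p - f q = (1 - frag_of (\<alpha> (p, q))) * r}"

definition graph_iso :: "'v pair_pre_digraph \<Rightarrow> 'w pair_pre_digraph \<Rightarrow> ('v \<Rightarrow> 'w) \<Rightarrow> bool" where
  "graph_iso G1 G2 \<Phi> \<longleftrightarrow> bij_betw \<Phi> (pverts G1) (pverts G2) \<and>
     (\<forall>u \<in> pverts G1. \<forall>v \<in> pverts G1. (u, v) \<in> parcs G1 \<longleftrightarrow> (\<Phi> u, \<Phi> v) \<in> parcs G2)"

definition linear_iso_on ::
  "'s::real_vector set \<Rightarrow> 't::real_vector set \<Rightarrow> ('s \<Rightarrow> 't) \<Rightarrow> bool" where
  "linear_iso_on U W \<Psi> \<longleftrightarrow> bij_betw \<Psi> U W \<and>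
     (\<forall>x\<in>U. \<forall>y\<in>U. \<Psi> (x + y) = \<Psi> x + \<Psi> y) \<and> (\<forall>a. \<forall>x\<in>U. \<Psi> (a *\<^sub>R x) = a *\<^sub>R \<Psi> x)"

text \<open>\<open>U\<^sub>i\<close> is the ambient space of weights of \<open>(G\<^sub>i, \<alpha>\<^sub>i)\<close> and \<open>L\<^sub>i\<close> the lattice in it.\<close>

definition gkm_iso ::
  "'s::real_vector set \<Rightarrow> 's set \<Rightarrow> 'v pair_pre_digraph \<Rightarrow> ('v \<times> 'v \<Rightarrow> 's) \<Rightarrow>
   't::real_vector set \<Rightarrow> 't set \<Rightarrow> 'w pair_pre_digraph \<Rightarrow> ('w \<times> 'w \<Rightarrow> 't) \<Rightarrow>
   ('v \<Rightarrow> 'w) \<times> ('s \<Rightarrow> 't) \<Rightarrow> bool" where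
  "gkm_iso U1 L1 G1 \<alpha>1 U2 L2 G2 \<alpha>2 = (\<lambda>(\<Phi>, \<Psi>).
     graph_iso G1 G2 \<Phi> \<and> linear_iso_on U1 U2 \<Psi> \<and> \<Psi> ` L1 = L2 \<and>
     (\<forall>(p, q) \<in> parcs G1. \<alpha>2 (\<Phi> p, \<Phi> q) = \<Psi> (\<alpha>1 (p, q))))"

section \<open>GKM fiber bundles\<close>

definition fiber :: "'v pair_pre_digraph \<Rightarrow> ('v \<Rightarrow> 'b) \<Rightarrow> 'b \<Rightarrow> 'v pair_pre_digraph" where
  "fiber G \<pi> p = \<lparr> pverts = {v \<in> pverts G. \<pi> v = p},
                   parcs = {(u, v) \<in> parcs G. \<pi> u = p \<and> \<pi> v = p} \<rparr>"

text \<open>The subspace \<open>\<vv>\<^sub>p*\<close>.\<close>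

definition fiber_span ::
  "'v pair_pre_digraph \<Rightarrow> ('v \<times> 'v \<Rightarrow> 't::real_vector) \<Rightarrow> ('v \<Rightarrow> 'b) \<Rightarrow> 'b \<Rightarrow> 't set" where
  "fiber_span G \<alpha> \<pi> p = span (\<alpha> ` parcs (fiber G \<pi> p))"

definition vertical :: "'v pair_pre_digraph \<Rightarrow> ('v \<Rightarrow> 'b) \<Rightarrow> ('v \<times> 'v) set" where
  "vertical G \<pi> = {(u, v) \<in> parcs G. \<pi> u = \<pi> v}"

definition horizontal ::
  "'v pair_pre_digraph \<Rightarrow> 'b pair_pre_digraph \<Rightarrow> ('v \<Rightarrow> 'b) \<Rightarrow> ('v \<times> 'v) set" where
  "horizontal G B \<pi> = {(u, v) \<in> parcs G. (\<pi> u, \<pi> v) \<in> parcs B}"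

text \<open>The map \<open>\<Phi>\<^bsub>p,q\<^esub>\<close> given by lifting the edge \<open>(p, q)\<close> of the base; under the
  bundle axioms the lift at each point of the fiber exists and is unique.\<close>

definition lift_map :: "'v pair_pre_digraph \<Rightarrow> ('v \<Rightarrow> 'b) \<Rightarrow> 'b \<Rightarrow> 'b \<Rightarrow> 'v \<Rightarrow> 'v" where
  "lift_map G \<pi> p q =
     (\<lambda>p' \<in> pverts (fiber G \<pi> p). THE q'. (p', q') \<in> parcs G \<and> \<pi> q' = q)"

text \<open>\<open>\<Psi> p q\<close> is determined by \<open>lift_map G \<pi> p q\<close> on \<open>\<vv>\<^sub>p*\<close>, and only its values there
  are ever used.\<close>

locale gkm_fiber_bundle =
  tot: gkm_graph G \<Lambda> \<alpha> conn + base: gkm_graph B \<Lambda> \<alpha>\<^sub>B conn\<^sub>B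
  for \<Lambda> :: "'t::real_vector set"
    and G :: "'v pair_pre_digraph" and \<alpha> conn
    and B :: "'b pair_pre_digraph" and \<alpha>\<^sub>B conn\<^sub>B +
  fixes \<pi> :: "'v \<Rightarrow> 'b" and \<Psi> :: "'b \<Rightarrow> 'b \<Rightarrow> 't \<Rightarrow> 't"
  assumes lattice: "weight_lattice \<Lambda>"
    and proj_surj: "\<pi> ` pverts G = pverts B"
    and proj_edge: "(u, v) \<in> parcs G \<Longrightarrow> \<pi> u = \<pi> v \<or> (\<pi> u, \<pi> v) \<in> parcs B"
    and dproj_bij: "u \<in> pverts G \<Longrightarrow>
      bij_betw (map_prod \<pi> \<pi>) (out_arcs (with_proj G) u \<inter> horizontal G B \<pi>)
        (out_arcs (with_proj B) (\<pi> u))"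
    and dproj_axial: "e \<in> horizontal G B \<pi> \<Longrightarrow> \<alpha>\<^sub>B (map_prod \<pi> \<pi> e) = \<alpha> e"
    and connection_horizontal: "\<lbrakk>(u, v) \<in> parcs G;
      e \<in> out_arcs (with_proj G) u \<inter> horizontal G B \<pi>\<rbrakk> \<Longrightarrow> conn (u, v) e \<in> horizontal G B \<pi>"
    and connection_vertical: "\<lbrakk>(u, v) \<in> parcs G;
      e \<in> out_arcs (with_proj G) u \<inter> vertical G \<pi>\<rbrakk> \<Longrightarrow> conn (u, v) e \<in> vertical G \<pi>"
    and connection_base: "\<lbrakk>(u, v) \<in> horizontal G B \<pi>;
      e \<in> out_arcs (with_proj G) u \<inter> horizontal G B \<pi>\<rbrakk> \<Longrightarrow>
      map_prod \<pi> \<pi> (conn (u, v) e) = conn\<^sub>B (\<pi> u, \<pi> v) (map_prod \<pi> \<pi> e)"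
    and lift_iso: "(p, q) \<in> parcs B \<Longrightarrow>
      graph_iso (fiber G \<pi> p) (fiber G \<pi> q) (lift_map G \<pi> p q)"
    and lift_connection: "\<lbrakk>(p, q) \<in> parcs B; (p\<^sub>1, q\<^sub>1) \<in> parcs G; \<pi> p\<^sub>1 = p; \<pi> q\<^sub>1 = q;
      (p\<^sub>1, p\<^sub>2) \<in> parcs (fiber G \<pi> p)\<rbrakk> \<Longrightarrow> conn (p\<^sub>1, q\<^sub>1) (p\<^sub>1, p\<^sub>2) = (q\<^sub>1, lift_map G \<pi> p q p\<^sub>2)"
    and transition_iso: "(p, q) \<in> parcs B \<Longrightarrow>
      gkm_iso (fiber_span G \<alpha> \<pi> p) (fiber_span G \<alpha> \<pi> p \<inter> \<Lambda>) (fiber G \<pi> p) \<alpha>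
              (fiber_span G \<alpha> \<pi> q) (fiber_span G \<alpha> \<pi> q \<inter> \<Lambda>) (fiber G \<pi> q) \<alpha>
              (lift_map G \<pi> p q, \<Psi> p q)"
    and transition_shift: "(p, q) \<in> parcs B \<Longrightarrow>
      \<exists>m :: 't \<Rightarrow> int. \<forall>x \<in> fiber_span G \<alpha> \<pi> p \<inter> \<Lambda>. \<Psi> p q x = x + of_int (m x) *\<^sub>R \<alpha>\<^sub>B (p, q)"

section \<open>Holonomy and invariant classes\<close>

definition paths :: "'b pair_pre_digraph \<Rightarrow> 'b \<Rightarrow> 'b \<Rightarrow> 'b vwalk set" where
  "paths B p q = {\<gamma>. vwalk \<gamma> (with_proj B) \<and> hd \<gamma> = p \<and> last \<gamma> = q}"

text \<open>The isomorphism \<open>\<Upsilon>\<^sub>\<gamma>\<close> from the fiber over \<open>hd \<gamma>\<close> to the fiber over \<open>last \<gamma>\<close>, as a pair of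
  functions with domains \<open>V\<^bsub>hd \<gamma>\<^esub>\<close> and \<open>\<vv>\<^bsub>hd \<gamma>\<^esub>*\<close>; paths are nonempty vertex lists.\<close>

fun path_iso ::
  "'v pair_pre_digraph \<Rightarrow> ('v \<times> 'v \<Rightarrow> 't::real_vector) \<Rightarrow> ('v \<Rightarrow> 'b) \<Rightarrow>
   ('b \<Rightarrow> 'b \<Rightarrow> 't \<Rightarrow> 't) \<Rightarrow> 'b vwalk \<Rightarrow> ('v \<Rightarrow> 'v) \<times> ('t \<Rightarrow> 't)" where
  "path_iso G \<alpha> \<pi> \<Psi> [] = undefined"
| "path_iso G \<alpha> \<pi> \<Psi> [p] =
     (restrict id (pverts (fiber G \<pi> p)), restrict id (fiber_span G \<alpha> \<pi> p))"
| "path_iso G \<alpha> \<pi> \<Psi> (p # q # \<gamma>) =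
     (compose (pverts (fiber G \<pi> p)) (fst (path_iso G \<alpha> \<pi> \<Psi> (q # \<gamma>))) (lift_map G \<pi> p q),
      compose (fiber_span G \<alpha> \<pi> p) (snd (path_iso G \<alpha> \<pi> \<Psi> (q # \<gamma>))) (\<Psi> p q))"

text \<open>\<open>\<Upsilon>*(f)(p') = \<Psi>\<inverse>(f(\<Phi>(p')))\<close> for \<open>\<Upsilon> = (\<Phi>, \<Psi>)\<close> starting at the fiber over \<open>p\<close>, where \<open>\<Psi>\<inverse>\<close> is
  extended to the group rings by \<open>exp (2 \<pi> \<i> x) \<mapsto> exp (2 \<pi> \<i> \<Psi>\<inverse>(x))\<close>, additively
  (\<open>frag_extend\<close>).\<close>

definition pullback ::
  "'v pair_pre_digraph \<Rightarrow> ('v \<times> 'v \<Rightarrow> 't::real_vector) \<Rightarrow> ('v \<Rightarrow> 'b) \<Rightarrow> 'b \<Rightarrow>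
   ('v \<Rightarrow> 'v) \<times> ('t \<Rightarrow> 't) \<Rightarrow> ('v \<Rightarrow> 't \<Rightarrow>\<^sub>0 int) \<Rightarrow> 'v \<Rightarrow> 't \<Rightarrow>\<^sub>0 int" where
  "pullback G \<alpha> \<pi> p = (\<lambda>(\<Phi>, \<Psi>) f. \<lambda>p' \<in> pverts (fiber G \<pi> p).
     frag_extend (\<lambda>x. frag_of (inv_into (fiber_span G \<alpha> \<pi> p) \<Psi> x)) (f (\<Phi> p')))"

definition fiber_K_ring ::
  "'t::real_vector set \<Rightarrow> 'v pair_pre_digraph \<Rightarrow> ('v \<times> 'v \<Rightarrow> 't) \<Rightarrow> ('v \<Rightarrow> 'b) \<Rightarrow> 'b \<Rightarrow>
   ('v \<Rightarrow> 't \<Rightarrow>\<^sub>0 int) set" where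
  "fiber_K_ring \<Lambda> G \<alpha> \<pi> p = K_ring (fiber_span G \<alpha> \<pi> p \<inter> \<Lambda>) (fiber G \<pi> p) \<alpha>"

definition holonomy ::
  "'v pair_pre_digraph \<Rightarrow> ('v \<times> 'v \<Rightarrow> 't::real_vector) \<Rightarrow> 'b pair_pre_digraph \<Rightarrow> ('v \<Rightarrow> 'b) \<Rightarrow>
   ('b \<Rightarrow> 'b \<Rightarrow> 't \<Rightarrow> 't) \<Rightarrow> 'b \<Rightarrow> (('v \<Rightarrow> 'v) \<times> ('t \<Rightarrow> 't)) set" where
  "holonomy G \<alpha> B \<pi> \<Psi> p = path_iso G \<alpha> \<pi> \<Psi> ` paths B p p"

definition invariant_classes ::
  "'t::real_vector set \<Rightarrow> 'v pair_pre_digraph \<Rightarrow> ('v \<times> 'v \<Rightarrow> 't) \<Rightarrow> 'b pair_pre_digraph \<Rightarrow>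
   ('v \<Rightarrow> 'b) \<Rightarrow> ('b \<Rightarrow> 'b \<Rightarrow> 't \<Rightarrow> 't) \<Rightarrow> 'b \<Rightarrow> ('v \<Rightarrow> 't \<Rightarrow>\<^sub>0 int) set" where
  "invariant_classes \<Lambda> G \<alpha> B \<pi> \<Psi> p = {f \<in> fiber_K_ring \<Lambda> G \<alpha> \<pi> p.
     \<forall>\<Upsilon> \<in> holonomy G \<alpha> B \<pi> \<Psi> p. pullback G \<alpha> \<pi> p \<Upsilon> f = f}"

text \<open>The class \<open>f\<^sub>q\<close>, i.e. the common value of \<open>\<Upsilon>\<^sub>\<gamma>*(f)\<close> over all paths \<open>\<gamma>\<close> from \<open>q\<close> to \<open>p\<close>.\<close>

definition transported_class ::
  "'v pair_pre_digraph \<Rightarrow> ('v \<times> 'v \<Rightarrow> 't::real_vector) \<Rightarrow> 'b pair_pre_digraph \<Rightarrow> ('v \<Rightarrow> 'b) \<Rightarrow>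
   ('b \<Rightarrow> 'b \<Rightarrow> 't \<Rightarrow> 't) \<Rightarrow> 'b \<Rightarrow> ('v \<Rightarrow> 't \<Rightarrow>\<^sub>0 int) \<Rightarrow> 'b \<Rightarrow> 'v \<Rightarrow> 't \<Rightarrow>\<^sub>0 int" where
  "transported_class G \<alpha> B \<pi> \<Psi> p f q =
     (THE g. \<exists>\<gamma> \<in> paths B q p. g = pullback G \<alpha> \<pi> q (path_iso G \<alpha> \<pi> \<Psi> \<gamma>) f)"

end

theory Submission
  imports Defs
begin

text \<open>On a vertical edge the divisibility condition is the one of \<open>f\<^sub>q\<close> in the \<open>K\<close>-ring of its fiber,
  which pullback preserves since it is induced by ring homomorphisms compatible with the axial
  functions.  For a horizontal edge \<open>(u, v)\<close> over \<open>(q, r)\<close>, the value \<open>c v\<close> is the image of \<open>c u\<close>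
  under \<open>\<Psi> q r\<close>; as \<open>\<Psi> q r\<close> moves every weight by an integer multiple of \<open>\<alpha> (u, v)\<close>, the
  difference \<open>c u - c v\<close> is divisible by \<open>1 - exp (2 \<pi> \<i> \<alpha> (u, v))\<close>.\<close>

section \<open>Homomorphisms of group rings\<close>

lemma keys_frag_extend_frag_of:
  "Poly_Mapping.keys (frag_extend (\<lambda>x. frag_of (\<phi> x)) r) \<subseteq> \<phi> ` Poly_Mapping.keys r"
  using keys_frag_extend[of "\<lambda>x. frag_of (\<phi> x)" r] by auto

lemma frag_extend_frag_of_comp:
  "frag_extend (\<lambda>x. frag_of (\<phi> x)) (frag_extend (\<lambda>x. frag_of (\<psi> x)) r)
    = frag_extend (\<lambda>x. frag_of (\<phi> (\<psi> x))) r"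
  using frag_extend_compose[of "\<lambda>x. frag_of (\<phi> x)" \<psi> r] by (simp add: o_def)

text \<open>The set \<open>S\<close> will be a fiber subspace: composites of a transition map with
  its inverse are controlled only there, and it contains all weights that occur.\<close>

lemma frag_extend_frag_of_ident:
  assumes "Poly_Mapping.keys r \<subseteq> S" "\<And>x. x \<in> S \<Longrightarrow> \<phi> x = x"
  shows "frag_extend (\<lambda>x. frag_of (\<phi> x)) r = r"
proof -
  have "frag_extend (\<lambda>x. frag_of (\<phi> x)) r = frag_extend frag_of r"
    by (rule frag_extend_eq) (use assms in auto)
  then show ?thesis by (simp flip: frag_expansion)
qed

text \<open>Both sides are biadditive in \<open>a\<close> and \<open>b\<close>, so the case
  \<open>frag_of x * frag_of y = frag_of (x + y)\<close> decides. Additivity is asked on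
  \<open>S\<close> alone because \<phi> will be an inverse \<open>inv_into\<close> that is additive
  on a fiber subspace.\<close>

lemma frag_extend_frag_of_mult:
  assumes add: "\<And>x y. \<lbrakk>x \<in> S; y \<in> S\<rbrakk> \<Longrightarrow> \<phi> (x + y) = \<phi> x + \<phi> y"
    and "Poly_Mapping.keys a \<subseteq> S" "Poly_Mapping.keys b \<subseteq> S"
  shows "frag_extend (\<lambda>x. frag_of (\<phi> x)) (a * b)
    = frag_extend (\<lambda>x. frag_of (\<phi> x)) a * frag_extend (\<lambda>x. frag_of (\<phi> x)) b"
  using assms(2)
proof (induction a rule: frag_induction)
  case (one x)
  from assms(3) show ?case
  proof (induction b rule: frag_induction)
    case (one y)
    with \<open>x \<in> S\<close> show ?case by (simp add: mult_single add)
  qed (simp_all add: right_diff_distrib frag_extend_diff)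
qed (simp_all add: left_diff_distrib frag_extend_diff)

section \<open>Divisibility by \<open>1 - frag_of a\<close>\<close>

lemma rep_ring_frag_of_mult:
  assumes "a \<in> L" "s \<in> rep_ring L" and add: "\<And>x y. \<lbrakk>x \<in> L; y \<in> L\<rbrakk> \<Longrightarrow> x + y \<in> L"
  shows "frag_of a * s \<in> rep_ring L"
proof -
  have "Poly_Mapping.keys s \<subseteq> L" using assms(2) by (simp add: rep_ring_def)
  then have "{x + y |x y. x \<in> Poly_Mapping.keys (frag_of a) \<and> y \<in> Poly_Mapping.keys s} \<subseteq> L"
    using assms(1) add by auto
  with keys_mult[of "frag_of a" s] show ?thesis unfolding rep_ring_def by blast
qed

text \<open>With X = \<open>frag_of a\<close> this is the geometric sum: 1 - X divides 1 - X^m, also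
  for negative m because X is a unit. The quotient is tracked inside \<open>rep_ring L\<close>,
  which is where the subgroup properties of \<open>L\<close> enter.\<close>

lemma frag_of_mult_int_dvd:
  fixes a :: "'t::real_vector"
  assumes "0 \<in> L" "a \<in> L" and add: "\<And>x y. \<lbrakk>x \<in> L; y \<in> L\<rbrakk> \<Longrightarrow> x + y \<in> L"
    and neg: "\<And>x. x \<in> L \<Longrightarrow> - x \<in> L"
  shows "\<exists>s \<in> rep_ring L. 1 - frag_of (of_int m *\<^sub>R a) = (1 - frag_of a) * s"
proof (induction m rule: int_induct[where k = 0])
  case base
  show ?case by (intro bexI[of _ 0]) (auto simp: rep_ring_def)
next
  case (step1 i)
  then obtain s where s: "s \<in> rep_ring L" "1 - frag_of (of_int i *\<^sub>R a) = (1 - frag_of a) * s"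
    by blast
  \<comment> \<open>Upward step: 1 - X^(i+1) = (1 - X) + X (1 - X^i).\<close>
  have "1 - frag_of (of_int (i + 1) *\<^sub>R a) = (1 - frag_of a) + frag_of a * (1 - frag_of (of_int i *\<^sub>R a))"
    by (simp add: algebra_simps mult_single)
  also have "\<dots> = (1 - frag_of a) * (1 + frag_of a * s)"
    unfolding s(2) by (simp add: algebra_simps)
  finally have eq: "1 - frag_of (of_int (i + 1) *\<^sub>R a) = (1 - frag_of a) * (1 + frag_of a * s)" .
  have "frag_of a * s \<in> rep_ring L"
    using \<open>a \<in> L\<close> s(1) add by (rule rep_ring_frag_of_mult)
  \<comment> \<open>The unit of the group ring is \<open>frag_of 0\<close>, so it lies in
    \<open>rep_ring L\<close> by \<open>0 \<in> L\<close>.\<close>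
  then have "1 + frag_of a * s \<in> rep_ring L"
    using keys_add[of 1 "frag_of a * s"] \<open>0 \<in> L\<close> by (auto simp: rep_ring_def)
  with eq show ?case by blast
next
  case (step2 i)
  then obtain s where s: "s \<in> rep_ring L" "1 - frag_of (of_int i *\<^sub>R a) = (1 - frag_of a) * s"
    by blast
  \<comment> \<open>Downward step: 1 - X^(i-1) = X^(-1) (X - 1) + X^(-1) (1 - X^i); pulling out 1 -
    X turns the first summand into the -1 in \<open>s - 1\<close>.\<close>
  have inv: "frag_of (- a) * frag_of a = 1" by (simp add: mult_single)
  have "1 - frag_of (of_int (i - 1) *\<^sub>R a) = frag_of (- a) * (frag_of a - 1)
      + frag_of (- a) * (1 - frag_of (of_int i *\<^sub>R a))"
    by (simp add: algebra_simps mult_single)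
  also have "\<dots> = (1 - frag_of a) * (frag_of (- a) * (s - 1))"
    unfolding s(2) by (simp add: algebra_simps)
  finally have eq: "1 - frag_of (of_int (i - 1) *\<^sub>R a) = (1 - frag_of a) * (frag_of (- a) * (s - 1))" .
  have "s - 1 \<in> rep_ring L"
    using keys_diff[of s 1] s(1) \<open>0 \<in> L\<close> by (auto simp: rep_ring_def)
  with neg[OF \<open>a \<in> L\<close>] have "frag_of (- a) * (s - 1) \<in> rep_ring L"
    using add by (rule rep_ring_frag_of_mult)
  with eq show ?case by blast
qed

text \<open>By additivity it suffices to treat a single weight \<open>x\<close>, where the
  difference is \<open>frag_of x\<close> times
  \<open>1 - frag_of (of_int (m x) *\<^sub>R a)\<close>. The shift is known on \<open>K\<close>, the
  weights of one fiber, while the quotient lives over the larger \<open>L\<close>, which contains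
  \<open>a\<close>.\<close>

lemma frag_extend_shift_dvd:
  fixes a :: "'t::real_vector" and \<psi> :: "'t \<Rightarrow> 't" and m :: "'t \<Rightarrow> int"
  assumes "0 \<in> L" "a \<in> L" and add: "\<And>x y. \<lbrakk>x \<in> L; y \<in> L\<rbrakk> \<Longrightarrow> x + y \<in> L"
    and neg: "\<And>x. x \<in> L \<Longrightarrow> - x \<in> L"
    and "K \<subseteq> L" and shift: "\<And>x. x \<in> K \<Longrightarrow> \<psi> x = x + of_int (m x) *\<^sub>R a"
    and "Poly_Mapping.keys g \<subseteq> K"
  shows "\<exists>s \<in> rep_ring L. g - frag_extend (\<lambda>x. frag_of (\<psi> x)) g = (1 - frag_of a) * s"
  using assms(7)
proof (induction g rule: frag_induction)
  case zero
  show ?case by (intro bexI[of _ 0]) (auto simp: rep_ring_def)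
next
  case (one x)
  obtain s where s: "s \<in> rep_ring L" "1 - frag_of (of_int (m x) *\<^sub>R a) = (1 - frag_of a) * s"
    using frag_of_mult_int_dvd[of L a "m x"] assms by blast
  have "frag_of x - frag_extend (\<lambda>x. frag_of (\<psi> x)) (frag_of x)
      = frag_of x * (1 - frag_of (of_int (m x) *\<^sub>R a))"
    using one by (simp add: shift algebra_simps mult_single)
  also have "\<dots> = (1 - frag_of a) * (frag_of x * s)"
    unfolding s(2) by (simp only: mult.left_commute)
  finally have eq: "frag_of x - frag_extend (\<lambda>x. frag_of (\<psi> x)) (frag_of x)
      = (1 - frag_of a) * (frag_of x * s)" .
  have "x \<in> L" using one \<open>K \<subseteq> L\<close> by blast
  then have "frag_of x * s \<in> rep_ring L"
    using s(1) add by (rule rep_ring_frag_of_mult)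
  with eq show ?case by blast
next
  case (diff g h)
  then obtain s t where s: "s \<in> rep_ring L" "g - frag_extend (\<lambda>x. frag_of (\<psi> x)) g = (1 - frag_of a) * s"
    and t: "t \<in> rep_ring L" "h - frag_extend (\<lambda>x. frag_of (\<psi> x)) h = (1 - frag_of a) * t"
    by blast
  have "(g - h) - frag_extend (\<lambda>x. frag_of (\<psi> x)) (g - h)
      = (g - frag_extend (\<lambda>x. frag_of (\<psi> x)) g) - (h - frag_extend (\<lambda>x. frag_of (\<psi> x)) h)"
    by (simp add: frag_extend_diff)
  also have "\<dots> = (1 - frag_of a) * (s - t)"
    by (simp add: s t right_diff_distrib)
  finally show ?case
    using s(1) t(1) keys_diff[of s t] by (intro bexI[of _ "s - t"]) (auto simp: rep_ring_def)
qed

lemma weight_lattice_subgroup: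
  assumes "weight_lattice \<Lambda>"
  shows "0 \<in> \<Lambda>" "\<lbrakk>x \<in> \<Lambda>; y \<in> \<Lambda>\<rbrakk> \<Longrightarrow> x + y \<in> \<Lambda>" "x \<in> \<Lambda> \<Longrightarrow> - x \<in> \<Lambda>"
proof -
  obtain B where B: "\<Lambda> = range (\<lambda>n :: 'a \<Rightarrow> int. \<Sum>b\<in>B. of_int (n b) *\<^sub>R b)"
    using assms by (auto simp: weight_lattice_def)
  show "0 \<in> \<Lambda>" unfolding B by (intro range_eqI[of _ _ "\<lambda>_. 0"]) simp
  show "x + y \<in> \<Lambda>" if xy: "x \<in> \<Lambda>" "y \<in> \<Lambda>"
  proof -
    obtain m n :: "'a \<Rightarrow> int" where "x = (\<Sum>b\<in>B. of_int (m b) *\<^sub>R b)" "y = (\<Sum>b\<in>B. of_int (n b) *\<^sub>R b)"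
      using xy unfolding B by blast
    then show ?thesis unfolding B
      by (intro range_eqI[of _ _ "\<lambda>b. m b + n b"]) (simp add: sum.distrib scaleR_left_distrib)
  qed
  show "- x \<in> \<Lambda>" if x: "x \<in> \<Lambda>"
  proof -
    obtain m :: "'a \<Rightarrow> int" where "x = (\<Sum>b\<in>B. of_int (m b) *\<^sub>R b)"
      using x unfolding B by blast
    then show ?thesis unfolding B
      by (intro range_eqI[of _ _ "\<lambda>b. - m b"]) (simp add: sum_negf)
  qed
qed

section \<open>Isomorphisms of fibers and pullback\<close>

abbreviation fiber_iso ::
  "'t::real_vector set \<Rightarrow> 'v pair_pre_digraph \<Rightarrow> ('v \<times> 'v \<Rightarrow> 't) \<Rightarrow> ('v \<Rightarrow> 'b) \<Rightarrow> 'b \<Rightarrow> 'b \<Rightarrow>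
   ('v \<Rightarrow> 'v) \<times> ('t \<Rightarrow> 't) \<Rightarrow> bool" where
  "fiber_iso \<Lambda> G \<alpha> \<pi> p q \<equiv>
     gkm_iso (fiber_span G \<alpha> \<pi> p) (fiber_span G \<alpha> \<pi> p \<inter> \<Lambda>) (fiber G \<pi> p) \<alpha>
             (fiber_span G \<alpha> \<pi> q) (fiber_span G \<alpha> \<pi> q \<inter> \<Lambda>) (fiber G \<pi> q) \<alpha>"

text \<open>This is the isomorphism of a constant path; the restrictions match the one-vertex clause
  of \<open>path_iso\<close>.\<close>

lemma gkm_iso_id:
  assumes "\<And>u v. (u, v) \<in> parcs G \<Longrightarrow> u \<in> pverts G \<and> v \<in> pverts G"
    and "\<And>e. e \<in> parcs G \<Longrightarrow> \<alpha> e \<in> U" "subspace U" "L \<subseteq> U"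
  shows "gkm_iso U L G \<alpha> U L G \<alpha> (restrict id (pverts G), restrict id U)"
proof -
  have "restrict id U ` L = L" using \<open>L \<subseteq> U\<close> by (auto simp: image_def subset_iff)
  with assms show ?thesis
    by (auto simp: gkm_iso_def graph_iso_def linear_iso_on_def bij_betw_def inj_on_def
        subspace_add subspace_scale)
qed

text \<open>Since \<open>compose\<close> is \<open>undefined\<close> off its domain, the side
  conditions ensure that endpoints of edges, axial values, sums and multiples all stay inside the
  domain.\<close>

lemma gkm_iso_compose:
  assumes "gkm_iso U1 L1 G1 \<alpha>1 U2 L2 G2 \<alpha>2 (\<Phi>, \<Psi>)"
    and "gkm_iso U2 L2 G2 \<alpha>2 U3 L3 G3 \<alpha>3 (\<Phi>', \<Psi>')"
    and arcs: "\<And>u v. (u, v) \<in> parcs G1 \<Longrightarrow> u \<in> pverts G1 \<and> v \<in> pverts G1"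
    and vals: "\<And>e. e \<in> parcs G1 \<Longrightarrow> \<alpha>1 e \<in> U1"
    and U: "subspace U1" and L: "L1 \<subseteq> U1"
  shows "gkm_iso U1 L1 G1 \<alpha>1 U3 L3 G3 \<alpha>3 (compose (pverts G1) \<Phi>' \<Phi>, compose U1 \<Psi>' \<Psi>)"
proof -
  have 1: "bij_betw \<Phi> (pverts G1) (pverts G2)" "bij_betw \<Psi> U1 U2" "\<Psi> ` L1 = L2"
    "\<And>x y. x \<in> U1 \<Longrightarrow> y \<in> U1 \<Longrightarrow> \<Psi> (x + y) = \<Psi> x + \<Psi> y"
    "\<And>a x. x \<in> U1 \<Longrightarrow> \<Psi> (a *\<^sub>R x) = a *\<^sub>R \<Psi> x"
    "\<And>u v. u \<in> pverts G1 \<Longrightarrow> v \<in> pverts G1 \<Longrightarrow> (u, v) \<in> parcs G1 \<longleftrightarrow> (\<Phi> u, \<Phi> v) \<in> parcs G2"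
    "\<And>u v. (u, v) \<in> parcs G1 \<Longrightarrow> \<alpha>2 (\<Phi> u, \<Phi> v) = \<Psi> (\<alpha>1 (u, v))"
    using assms(1) by (auto simp: gkm_iso_def graph_iso_def linear_iso_on_def)
  have 2: "bij_betw \<Phi>' (pverts G2) (pverts G3)" "bij_betw \<Psi>' U2 U3" "\<Psi>' ` L2 = L3"
    "\<And>x y. x \<in> U2 \<Longrightarrow> y \<in> U2 \<Longrightarrow> \<Psi>' (x + y) = \<Psi>' x + \<Psi>' y"
    "\<And>a x. x \<in> U2 \<Longrightarrow> \<Psi>' (a *\<^sub>R x) = a *\<^sub>R \<Psi>' x"
    "\<And>u v. u \<in> pverts G2 \<Longrightarrow> v \<in> pverts G2 \<Longrightarrow> (u, v) \<in> parcs G2 \<longleftrightarrow> (\<Phi>' u, \<Phi>' v) \<in> parcs G3"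
    "\<And>u v. (u, v) \<in> parcs G2 \<Longrightarrow> \<alpha>3 (\<Phi>' u, \<Phi>' v) = \<Psi>' (\<alpha>2 (u, v))"
    using assms(2) by (auto simp: gkm_iso_def graph_iso_def linear_iso_on_def)
  have V: "\<And>u. u \<in> pverts G1 \<Longrightarrow> \<Phi> u \<in> pverts G2" and S: "\<And>x. x \<in> U1 \<Longrightarrow> \<Psi> x \<in> U2"
    using 1(1,2) by (auto simp: bij_betw_def)
  have bij: "bij_betw (compose (pverts G1) \<Phi>' \<Phi>) (pverts G1) (pverts G3)"
    "bij_betw (compose U1 \<Psi>' \<Psi>) U1 U3"
    using 1(1,2) 2(1,2) by (auto intro: bij_betw_compose)
  have "compose U1 \<Psi>' \<Psi> ` L1 = \<Psi>' ` \<Psi> ` L1"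
    using L by (auto simp: compose_def image_image intro!: image_cong)
  then have lat: "compose U1 \<Psi>' \<Psi> ` L1 = L3" by (simp add: 1(3) 2(3))
  have lin: "linear_iso_on U1 U3 (compose U1 \<Psi>' \<Psi>)"
    using bij(2) U by (auto simp: linear_iso_on_def compose_eq subspace_add subspace_scale 1(4,5) 2(4,5) S)
  have gr: "graph_iso G1 G3 (compose (pverts G1) \<Phi>' \<Phi>)"
    using bij(1) by (simp add: graph_iso_def compose_eq 1(6) 2(6) V)
  have "\<alpha>3 (compose (pverts G1) \<Phi>' \<Phi> u, compose (pverts G1) \<Phi>' \<Phi> v) = compose U1 \<Psi>' \<Psi> (\<alpha>1 (u, v))"
    if e: "(u, v) \<in> parcs G1" for u v
  proof -
    have "(\<Phi> u, \<Phi> v) \<in> parcs G2" using e arcs[OF e] 1(6) by blast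
    from 2(7)[OF this] show ?thesis using e arcs[OF e] vals[OF e] 1(7) by (simp add: compose_eq)
  qed
  with lat lin gr show ?thesis by (auto simp: gkm_iso_def)
qed

section \<open>Pullback of classes between fibers\<close>

lemma subspace_fiber_span: "subspace (fiber_span G \<alpha> \<pi> p)"
  by (simp add: fiber_span_def)

lemma axial_fiber_span: "e \<in> parcs (fiber G \<pi> p) \<Longrightarrow> \<alpha> e \<in> fiber_span G \<alpha> \<pi> p"
  by (simp add: fiber_span_def span_base)

lemma fiber_K_ringD:
  assumes "f \<in> fiber_K_ring \<Lambda> G \<alpha> \<pi> p" "u \<in> pverts (fiber G \<pi> p)"
  shows "Poly_Mapping.keys (f u) \<subseteq> fiber_span G \<alpha> \<pi> p" "Poly_Mapping.keys (f u) \<subseteq> \<Lambda>"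
  using assms by (auto simp: fiber_K_ring_def K_ring_def rep_ring_def dest!: PiE_mem)

lemma fiber_K_ring_ext:
  "f \<in> fiber_K_ring \<Lambda> G \<alpha> \<pi> p \<Longrightarrow> f \<in> extensional (pverts (fiber G \<pi> p))"
  by (auto simp: fiber_K_ring_def K_ring_def PiE_def)

lemma pullback_apply:
  "p' \<in> pverts (fiber G \<pi> p) \<Longrightarrow> pullback G \<alpha> \<pi> p (\<Phi>, \<Psi>) f p' =
     frag_extend (\<lambda>x. frag_of (inv_into (fiber_span G \<alpha> \<pi> p) \<Psi> x)) (f (\<Phi> p'))"
  by (simp add: pullback_def)

lemma pullback_ext: "pullback G \<alpha> \<pi> p \<Upsilon> f \<in> extensional (pverts (fiber G \<pi> p))"
  by (simp add: pullback_def split: prod.split)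

lemma pullback_id:
  assumes "f \<in> fiber_K_ring \<Lambda> G \<alpha> \<pi> p"
  shows "pullback G \<alpha> \<pi> p
    (restrict id (pverts (fiber G \<pi> p)), restrict id (fiber_span G \<alpha> \<pi> p)) f = f"
proof (rule extensionalityI[OF pullback_ext fiber_K_ring_ext[OF assms]])
  fix u assume u: "u \<in> pverts (fiber G \<pi> p)"
  have "inv_into (fiber_span G \<alpha> \<pi> p) (restrict id (fiber_span G \<alpha> \<pi> p)) x = x"
    if "x \<in> fiber_span G \<alpha> \<pi> p" for x
    using that by (intro inv_into_f_eq) (auto simp: inj_on_def)
  with fiber_K_ringD(1)[OF assms u] u
  show "pullback G \<alpha> \<pi> p
    (restrict id (pverts (fiber G \<pi> p)), restrict id (fiber_span G \<alpha> \<pi> p)) f u = f u"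
    by (simp add: pullback_apply frag_extend_frag_of_ident)
qed

lemma fiber_isoD:
  assumes "fiber_iso \<Lambda> G \<alpha> \<pi> p q (\<Phi>, \<Psi>)"
  shows "bij_betw \<Phi> (pverts (fiber G \<pi> p)) (pverts (fiber G \<pi> q))"
    and "bij_betw \<Psi> (fiber_span G \<alpha> \<pi> p) (fiber_span G \<alpha> \<pi> q)"
  using assms by (auto simp: gkm_iso_def graph_iso_def linear_iso_on_def)

text \<open>On elements supported in the subspace over \<open>q\<close>, as the values of
  \<open>f\<close> are, the extension of \<Psi> undoes that of its inverse. This gives the
  injectivity of pullback and, for a transition isomorphism, the relation between the values of a
  class at the two ends of a horizontal edge.\<close>

lemma fiber_iso_extend_inverse:
  assumes "fiber_iso \<Lambda> G \<alpha> \<pi> p q (\<Phi>, \<Psi>)" "f \<in> fiber_K_ring \<Lambda> G \<alpha> \<pi> q"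
    and "u \<in> pverts (fiber G \<pi> p)"
  shows "frag_extend (\<lambda>x. frag_of (\<Psi> x)) (pullback G \<alpha> \<pi> p (\<Phi>, \<Psi>) f u) = f (\<Phi> u)"
proof -
  note bij = fiber_isoD[OF assms(1)]
  have "\<Phi> u \<in> pverts (fiber G \<pi> q)" using bij(1) assms(3) by (auto simp: bij_betw_def)
  with fiber_K_ringD(1)[OF assms(2)] have "Poly_Mapping.keys (f (\<Phi> u)) \<subseteq> fiber_span G \<alpha> \<pi> q" .
  then have "frag_extend (\<lambda>x. frag_of (\<Psi> (inv_into (fiber_span G \<alpha> \<pi> p) \<Psi> x))) (f (\<Phi> u)) = f (\<Phi> u)"
    by (rule frag_extend_frag_of_ident) (use bij(2) in \<open>auto simp: bij_betw_def f_inv_into_f\<close>)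
  with assms(3) show ?thesis
    by (simp add: pullback_apply frag_extend_frag_of_comp)
qed

lemma pullback_inj:
  assumes "fiber_iso \<Lambda> G \<alpha> \<pi> p q (\<Phi>, \<Psi>)"
  shows "inj_on (pullback G \<alpha> \<pi> p (\<Phi>, \<Psi>)) (fiber_K_ring \<Lambda> G \<alpha> \<pi> q)"
proof (rule inj_onI)
  fix f g assume f: "f \<in> fiber_K_ring \<Lambda> G \<alpha> \<pi> q" and g: "g \<in> fiber_K_ring \<Lambda> G \<alpha> \<pi> q"
    and eq: "pullback G \<alpha> \<pi> p (\<Phi>, \<Psi>) f = pullback G \<alpha> \<pi> p (\<Phi>, \<Psi>) g"
  show "f = g"
  proof (rule extensionalityI[OF fiber_K_ring_ext[OF f] fiber_K_ring_ext[OF g]])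
    fix v assume "v \<in> pverts (fiber G \<pi> q)"
    \<comment> \<open>Every vertex over \<open>q\<close> is some \<open>\<Phi> u\<close>, and the
      value there is recovered from the pullback at \<open>u\<close>.\<close>
    then obtain u where "u \<in> pverts (fiber G \<pi> p)" "v = \<Phi> u"
      using fiber_isoD(1)[OF assms] by (auto simp: bij_betw_def)
    then show "f v = g v"
      using fiber_iso_extend_inverse[OF assms] f g eq by metis
  qed
qed

text \<open>Contravariance comes down to inverting a composite: on the subspace over
  \<open>r\<close>, which holds the weights of \<open>f\<close>, the inverse of the composite is the
  composite of the inverses in reverse order.\<close>

lemma pullback_compose:
  assumes i: "fiber_iso \<Lambda> G \<alpha> \<pi> p q (\<Phi>, \<Psi>)" and j: "fiber_iso \<Lambda> G \<alpha> \<pi> q r (\<Phi>', \<Psi>')"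
    and f: "f \<in> fiber_K_ring \<Lambda> G \<alpha> \<pi> r"
  shows "pullback G \<alpha> \<pi> p (compose (pverts (fiber G \<pi> p)) \<Phi>' \<Phi>,
      compose (fiber_span G \<alpha> \<pi> p) \<Psi>' \<Psi>) f
    = pullback G \<alpha> \<pi> p (\<Phi>, \<Psi>) (pullback G \<alpha> \<pi> q (\<Phi>', \<Psi>') f)"
proof (rule extensionalityI[OF pullback_ext pullback_ext])
  fix u assume u: "u \<in> pverts (fiber G \<pi> p)"
  have v: "\<Phi> u \<in> pverts (fiber G \<pi> q)" and w: "\<Phi>' (\<Phi> u) \<in> pverts (fiber G \<pi> r)"
    using fiber_isoD(1)[OF i] fiber_isoD(1)[OF j] u by (auto simp: bij_betw_def)
  note b = fiber_isoD(2)[OF i] and b' = fiber_isoD(2)[OF j]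
  have "inv_into (fiber_span G \<alpha> \<pi> p) (compose (fiber_span G \<alpha> \<pi> p) \<Psi>' \<Psi>) x
      = inv_into (fiber_span G \<alpha> \<pi> p) \<Psi> (inv_into (fiber_span G \<alpha> \<pi> q) \<Psi>' x)"
    if x: "x \<in> fiber_span G \<alpha> \<pi> r" for x
  proof (rule inv_into_f_eq)
    show "inj_on (compose (fiber_span G \<alpha> \<pi> p) \<Psi>' \<Psi>) (fiber_span G \<alpha> \<pi> p)"
      using bij_betw_compose[OF b b'] by (simp add: bij_betw_def)
    have y: "inv_into (fiber_span G \<alpha> \<pi> q) \<Psi>' x \<in> fiber_span G \<alpha> \<pi> q"
      and y': "\<Psi>' (inv_into (fiber_span G \<alpha> \<pi> q) \<Psi>' x) = x"
      using b' x by (auto simp: bij_betw_def inv_into_into f_inv_into_f)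
    then show z: "inv_into (fiber_span G \<alpha> \<pi> p) \<Psi> (inv_into (fiber_span G \<alpha> \<pi> q) \<Psi>' x) \<in> fiber_span G \<alpha> \<pi> p"
      using b by (auto simp: bij_betw_def inv_into_into)
    have "\<Psi> (inv_into (fiber_span G \<alpha> \<pi> p) \<Psi> (inv_into (fiber_span G \<alpha> \<pi> q) \<Psi>' x))
        = inv_into (fiber_span G \<alpha> \<pi> q) \<Psi>' x"
      using y b by (auto simp: bij_betw_def f_inv_into_f)
    with z y' show "compose (fiber_span G \<alpha> \<pi> p) \<Psi>' \<Psi>
        (inv_into (fiber_span G \<alpha> \<pi> p) \<Psi> (inv_into (fiber_span G \<alpha> \<pi> q) \<Psi>' x)) = x"
      by (simp add: compose_eq)
  qed
  then have "frag_extend (\<lambda>x. frag_of (inv_into (fiber_span G \<alpha> \<pi> p) (compose (fiber_span G \<alpha> \<pi> p) \<Psi>' \<Psi>) x)) (f (\<Phi>' (\<Phi> u)))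
      = frag_extend (\<lambda>x. frag_of (inv_into (fiber_span G \<alpha> \<pi> p) \<Psi> (inv_into (fiber_span G \<alpha> \<pi> q) \<Psi>' x))) (f (\<Phi>' (\<Phi> u)))"
    using fiber_K_ringD(1)[OF f w] by (intro frag_extend_eq) auto
  with u v show "pullback G \<alpha> \<pi> p (compose (pverts (fiber G \<pi> p)) \<Phi>' \<Phi>,
      compose (fiber_span G \<alpha> \<pi> p) \<Psi>' \<Psi>) f u
    = pullback G \<alpha> \<pi> p (\<Phi>, \<Psi>) (pullback G \<alpha> \<pi> q (\<Phi>', \<Psi>') f) u"
    by (simp add: pullback_apply compose_eq frag_extend_frag_of_comp)
qed

lemma linear_iso_on_inv_add:
  assumes "linear_iso_on U W \<psi>" "subspace U" "x \<in> W" "y \<in> W"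
  shows "inv_into U \<psi> (x + y) = inv_into U \<psi> x + inv_into U \<psi> y"
proof (rule inv_into_f_eq)
  have b: "inj_on \<psi> U" "\<psi> ` U = W"
    and add: "\<And>x y. x \<in> U \<Longrightarrow> y \<in> U \<Longrightarrow> \<psi> (x + y) = \<psi> x + \<psi> y"
    using assms(1) by (auto simp: linear_iso_on_def bij_betw_def)
  show "inj_on \<psi> U" by (rule b)
  have mem: "inv_into U \<psi> x \<in> U" "inv_into U \<psi> y \<in> U"
    using assms b by (auto simp: inv_into_into)
  then show "inv_into U \<psi> x + inv_into U \<psi> y \<in> U" using \<open>subspace U\<close> by (simp add: subspace_add)
  show "\<psi> (inv_into U \<psi> x + inv_into U \<psi> y) = x + y"
    using assms b mem by (simp add: add f_inv_into_f)
qed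

context pair_wf_digraph
begin

lemma fiber_arcs_verts:
  "(u, v) \<in> parcs (fiber G \<pi> p) \<Longrightarrow> u \<in> pverts (fiber G \<pi> p) \<and> v \<in> pverts (fiber G \<pi> p)"
  using arc_fst_in_verts arc_snd_in_verts by (fastforce simp: fiber_def)

text \<open>Let \<open>?E\<close> be the ring map induced by the inverse of \<Psi>. Applied to the
  divisibility condition of \<open>f\<close> at the edge \<open>(\<Phi> u, \<Phi> v)\<close>, it
  turns the factor \<open>1 - frag_of (\<Psi> (\<alpha> (u, v)))\<close> into
  \<open>1 - frag_of (\<alpha> (u, v))\<close>.\<close>

lemma pullback_fiber_K_ring:
  assumes iso: "fiber_iso \<Lambda> G \<alpha> \<pi> p q (\<Phi>, \<Psi>)" and f: "f \<in> fiber_K_ring \<Lambda> G \<alpha> \<pi> q"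
  shows "pullback G \<alpha> \<pi> p (\<Phi>, \<Psi>) f \<in> fiber_K_ring \<Lambda> G \<alpha> \<pi> p"
proof -
  let ?S = "fiber_span G \<alpha> \<pi> p" and ?T = "fiber_span G \<alpha> \<pi> q"
  let ?E = "frag_extend (\<lambda>x. frag_of (inv_into ?S \<Psi> x))"
  note bij = fiber_isoD(2)[OF iso]
  have gr: "graph_iso (fiber G \<pi> p) (fiber G \<pi> q) \<Phi>" and lin: "linear_iso_on ?S ?T \<Psi>"
    and lat: "\<Psi> ` (?S \<inter> \<Lambda>) = ?T \<inter> \<Lambda>"
    and ax: "\<forall>(u, v) \<in> parcs (fiber G \<pi> p). \<alpha> (\<Phi> u, \<Phi> v) = \<Psi> (\<alpha> (u, v))"
    using iso unfolding gkm_iso_def split by blast+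
  have ax: "\<alpha> (\<Phi> u, \<Phi> v) = \<Psi> (\<alpha> (u, v))" if "(u, v) \<in> parcs (fiber G \<pi> p)" for u v
    using ax that by blast
  have V: "\<Phi> u \<in> pverts (fiber G \<pi> q)" if "u \<in> pverts (fiber G \<pi> p)" for u
    using bij_betwE[OF fiber_isoD(1)[OF iso]] that by blast
  have arcs: "(\<Phi> u, \<Phi> v) \<in> parcs (fiber G \<pi> q)" if "(u, v) \<in> parcs (fiber G \<pi> p)" for u v
    using gr that fiber_arcs_verts[OF that] unfolding graph_iso_def by blast
  have inv: "inv_into ?S \<Psi> (\<Psi> x) = x" if "x \<in> ?S" for x
    using that bij by (simp add: bij_betw_def)
  have E: "?E r \<in> rep_ring (?S \<inter> \<Lambda>)" if r: "r \<in> rep_ring (?T \<inter> \<Lambda>)" for r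
  proof -
    \<comment> \<open>As \<Psi> maps the lattice of one fiber onto that of the other, its inverse
      maps integral weights to integral weights.\<close>
    have "inv_into ?S \<Psi> ` (?T \<inter> \<Lambda>) = ?S \<inter> \<Lambda>"
      unfolding lat[symmetric] image_image using inv by auto
    with keys_frag_extend_frag_of[of "inv_into ?S \<Psi>" r] r show ?thesis
      unfolding rep_ring_def by blast
  qed
  have "\<exists>r \<in> rep_ring (?S \<inter> \<Lambda>). pullback G \<alpha> \<pi> p (\<Phi>, \<Psi>) f u - pullback G \<alpha> \<pi> p (\<Phi>, \<Psi>) f v
      = (1 - frag_of (\<alpha> (u, v))) * r" if e: "(u, v) \<in> parcs (fiber G \<pi> p)" for u v
  proof -
    obtain r where r: "r \<in> rep_ring (?T \<inter> \<Lambda>)"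
      and eq: "f (\<Phi> u) - f (\<Phi> v) = (1 - frag_of (\<Psi> (\<alpha> (u, v)))) * r"
      using f arcs[OF e] ax[OF e] by (fastforce simp: fiber_K_ring_def K_ring_def)
    have m: "\<alpha> (u, v) \<in> ?S" using e by (rule axial_fiber_span)
    have m': "\<Psi> (\<alpha> (u, v)) \<in> ?T" using m bij by (auto simp: bij_betw_def)
    have 0: "0 \<in> ?S" "0 \<in> ?T" by (simp_all add: subspace_0 subspace_fiber_span)
    \<comment> \<open>Homogeneity with scalar 0 gives \<open>\<Psi> 0 = 0\<close>; since the unit is
      \<open>frag_of 0\<close>, this is what makes \<open>?E\<close> preserve it.\<close>
    have "\<Psi> (0 *\<^sub>R 0) = 0 *\<^sub>R \<Psi> 0" using lin 0(1) unfolding linear_iso_on_def by blast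
    then have \<Psi>0: "\<Psi> 0 = 0" by simp
    have one: "?E 1 = 1"
      using inv[OF 0(1)] \<Psi>0 by (simp flip: single_one)
    have "Poly_Mapping.keys (1 - frag_of (\<Psi> (\<alpha> (u, v)))) \<subseteq> ?T"
      using keys_diff[of 1 "frag_of (\<Psi> (\<alpha> (u, v)))"] 0 m' by auto
    moreover have "Poly_Mapping.keys r \<subseteq> ?T" using r by (auto simp: rep_ring_def)
    ultimately have "?E (f (\<Phi> u) - f (\<Phi> v)) = ?E (1 - frag_of (\<Psi> (\<alpha> (u, v)))) * ?E r"
      unfolding eq
      by (intro frag_extend_frag_of_mult[where S = ?T] linear_iso_on_inv_add[OF lin subspace_fiber_span])
    also have "\<dots> = (1 - frag_of (\<alpha> (u, v))) * ?E r"
      by (simp add: frag_extend_diff one inv[OF m])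
    finally show ?thesis
      using E[OF r] fiber_arcs_verts[OF e] by (auto simp: pullback_apply frag_extend_diff)
  qed
  moreover have "pullback G \<alpha> \<pi> p (\<Phi>, \<Psi>) f u \<in> rep_ring (?S \<inter> \<Lambda>)"
    if u: "u \<in> pverts (fiber G \<pi> p)" for u
    using f V[OF u] u E by (auto simp: fiber_K_ring_def K_ring_def pullback_apply)
  ultimately show ?thesis
    by (auto simp: fiber_K_ring_def K_ring_def PiE_def pullback_ext)
qed

end

section \<open>Transport along paths\<close>

context gkm_fiber_bundle
begin

lemma paths_ConsI: "\<lbrakk>(q, r) \<in> parcs B; \<gamma> \<in> paths B r p\<rbrakk> \<Longrightarrow> q # \<gamma> \<in> paths B q p"
  using base.arc_fst_in_verts[of "(q, r)"]
  by (auto simp: paths_def neq_Nil_conv vwalk_def intro!: vwalk_consI)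

lemma paths_cases:
  assumes "\<gamma> \<in> paths B q p"
  obtains (Nil) "\<gamma> = [q]" "p = q" "q \<in> pverts B"
  | (Cons) r \<delta> where "\<gamma> = q # r # \<delta>" "(q, r) \<in> parcs B" "r # \<delta> \<in> paths B r p"
proof (cases \<gamma>)
  case (Cons a \<epsilon>)
  with assms that show thesis by (cases \<epsilon>) (auto simp: paths_def)
qed (use assms in \<open>auto simp: paths_def\<close>)

lemma paths_Nil: "[] \<notin> paths B q p"
  by (simp add: paths_def vwalk_def)

lemma path_iso_fiber_iso:
  "\<gamma> \<in> paths B q p \<Longrightarrow> fiber_iso \<Lambda> G \<alpha> \<pi> q p (path_iso G \<alpha> \<pi> \<Psi> \<gamma>)"
proof (induction \<gamma> arbitrary: q)
  case (Cons a \<epsilon>)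
  from Cons.prems show ?case
  proof (cases rule: paths_cases)
    case Nil
    then show ?thesis
      by (simp add: gkm_iso_id tot.fiber_arcs_verts axial_fiber_span subspace_fiber_span)
  next
    case (Cons r \<delta>)
    with Cons.IH[of r] have "fiber_iso \<Lambda> G \<alpha> \<pi> r p (path_iso G \<alpha> \<pi> \<Psi> (r # \<delta>))" by simp
    then have "fiber_iso \<Lambda> G \<alpha> \<pi> r p
        (fst (path_iso G \<alpha> \<pi> \<Psi> (r # \<delta>)), snd (path_iso G \<alpha> \<pi> \<Psi> (r # \<delta>)))" by simp
    from gkm_iso_compose[OF transition_iso[OF Cons(2)] this] show ?thesis
      by (simp add: Cons(1) tot.fiber_arcs_verts axial_fiber_span subspace_fiber_span)
  qed
qed (simp add: paths_Nil)

lemma pullback_path_fiber_K_ring: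
  "\<lbrakk>\<gamma> \<in> paths B q p; f \<in> fiber_K_ring \<Lambda> G \<alpha> \<pi> p\<rbrakk> \<Longrightarrow>
    pullback G \<alpha> \<pi> q (path_iso G \<alpha> \<pi> \<Psi> \<gamma>) f \<in> fiber_K_ring \<Lambda> G \<alpha> \<pi> q"
  using tot.pullback_fiber_K_ring path_iso_fiber_iso by (metis surj_pair)

text \<open>Pullback is contravariant, so the first edge of the path acts last.\<close>

lemma pullback_path_Cons:
  assumes "(q, r) \<in> parcs B" "\<gamma> \<in> paths B r p" "f \<in> fiber_K_ring \<Lambda> G \<alpha> \<pi> p"
  shows "pullback G \<alpha> \<pi> q (path_iso G \<alpha> \<pi> \<Psi> (q # \<gamma>)) f
    = pullback G \<alpha> \<pi> q (lift_map G \<pi> q r, \<Psi> q r) (pullback G \<alpha> \<pi> r (path_iso G \<alpha> \<pi> \<Psi> \<gamma>) f)"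
proof -
  \<comment> \<open>Exposing the initial vertex \<open>r\<close> of the remaining path makes the
    recursive clause of \<open>path_iso\<close> apply.\<close>
  obtain \<delta> where \<gamma>: "\<gamma> = r # \<delta>" using assms(2) by (cases rule: paths_cases) auto
  have "fiber_iso \<Lambda> G \<alpha> \<pi> r p (fst (path_iso G \<alpha> \<pi> \<Psi> \<gamma>), snd (path_iso G \<alpha> \<pi> \<Psi> \<gamma>))"
    using path_iso_fiber_iso[OF assms(2)] by simp
  from pullback_compose[OF transition_iso[OF assms(1)] this assms(3)] show ?thesis
    by (simp add: \<gamma>)
qed

text \<open>The common vertex \<open>q\<close> ends \<gamma> and begins \<delta>;
  \<open>tl \<delta>\<close> keeps it from occurring twice in the concatenation.\<close>

lemma pullback_path_append:
  assumes "\<delta> \<in> paths B q p" "f \<in> fiber_K_ring \<Lambda> G \<alpha> \<pi> p"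
  shows "\<gamma> \<in> paths B r q \<Longrightarrow> \<gamma> @ tl \<delta> \<in> paths B r p \<and>
    pullback G \<alpha> \<pi> r (path_iso G \<alpha> \<pi> \<Psi> (\<gamma> @ tl \<delta>)) f
      = pullback G \<alpha> \<pi> r (path_iso G \<alpha> \<pi> \<Psi> \<gamma>) (pullback G \<alpha> \<pi> q (path_iso G \<alpha> \<pi> \<Psi> \<delta>) f)"
proof (induction \<gamma> arbitrary: r)
  case (Cons a \<epsilon>)
  note K = pullback_path_fiber_K_ring[OF assms]
  from Cons.prems show ?case
  proof (cases rule: paths_cases)
    case Nil
    \<comment> \<open>For a constant \<gamma> the concatenation is \<delta> itself, and the pullback
      along \<gamma> is the identity.\<close>
    moreover have "q # tl \<delta> = \<delta>" using assms(1) by (cases rule: paths_cases) auto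
    ultimately show ?thesis using assms(1) pullback_id[OF K] by simp
  next
    case (Cons s \<epsilon>')
    note IH = Cons.IH[of s]
    have \<epsilon>: "\<epsilon> \<in> paths B s q" "a = r" using Cons by auto
    then show ?thesis
      using IH pullback_path_Cons[OF Cons(2) \<epsilon>(1) K] pullback_path_Cons[OF Cons(2) _ assms(2)]
        paths_ConsI[OF Cons(2)] by simp
  qed
qed (simp add: paths_Nil)

text \<open>Connectedness refers to the underlying undirected graph; because every edge of the base
  has its reverse, it yields directed paths between any two vertices.\<close>

lemma paths_nonempty:
  assumes "Digraph_Component.connected (with_proj B)" "p \<in> pverts B" "q \<in> pverts B"
  shows "paths B p q \<noteq> {}"
proof -
  have "strongly_connected (with_proj B)"
    using assms(1) by (intro base.symmetric_connected_imp_strongly_connected base.sym_arcs)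
  with assms(2,3) have "p \<rightarrow>\<^sup>*\<^bsub>with_proj B\<^esub> q" by auto
  then show ?thesis by (auto simp: base.reachable_vwalk_conv paths_def)
qed

text \<open>Prepending a path from \<open>p\<close> to \<open>q\<close> turns both paths into loops, and pulling back along the
  prepended path is injective; so no inverses of the transition maps are needed.\<close>

lemma pullback_path_independent:
  assumes "Digraph_Component.connected (with_proj B)" "p \<in> pverts B" "q \<in> pverts B"
    and f: "f \<in> invariant_classes \<Lambda> G \<alpha> B \<pi> \<Psi> p"
    and \<gamma>: "\<gamma> \<in> paths B q p" and \<delta>: "\<delta> \<in> paths B q p"
  shows "pullback G \<alpha> \<pi> q (path_iso G \<alpha> \<pi> \<Psi> \<gamma>) f = pullback G \<alpha> \<pi> q (path_iso G \<alpha> \<pi> \<Psi> \<delta>) f"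
proof -
  have K: "f \<in> fiber_K_ring \<Lambda> G \<alpha> \<pi> p" using f by (simp add: invariant_classes_def)
  obtain \<epsilon> where \<epsilon>: "\<epsilon> \<in> paths B p q" using paths_nonempty[OF assms(1-3)] by blast
  have loop: "pullback G \<alpha> \<pi> p (path_iso G \<alpha> \<pi> \<Psi> \<epsilon>) (pullback G \<alpha> \<pi> q (path_iso G \<alpha> \<pi> \<Psi> \<eta>) f) = f"
    if \<eta>: "\<eta> \<in> paths B q p" for \<eta>
    using pullback_path_append[OF \<eta> K \<epsilon>] f by (auto simp: invariant_classes_def holonomy_def)
  have "inj_on (pullback G \<alpha> \<pi> p (path_iso G \<alpha> \<pi> \<Psi> \<epsilon>)) (fiber_K_ring \<Lambda> G \<alpha> \<pi> q)"
    using pullback_inj path_iso_fiber_iso[OF \<epsilon>] by (metis surj_pair)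
  then show ?thesis
    by (rule inj_onD) (use loop \<gamma> \<delta> pullback_path_fiber_K_ring K in auto)
qed

section \<open>The classes transported to the other fibers\<close>

lemma transported_class_eq:
  assumes "Digraph_Component.connected (with_proj B)" "p \<in> pverts B" "q \<in> pverts B"
    and "f \<in> invariant_classes \<Lambda> G \<alpha> B \<pi> \<Psi> p" "\<gamma> \<in> paths B q p"
  shows "transported_class G \<alpha> B \<pi> \<Psi> p f q = pullback G \<alpha> \<pi> q (path_iso G \<alpha> \<pi> \<Psi> \<gamma>) f"
  \<comment> \<open>Path independence supplies the uniqueness that the definite description
    requires.\<close>
  unfolding transported_class_def
  using assms(5) pullback_path_independent[OF assms(1-4)] by (intro the_equality) blast+

lemma transported_class_K_ring:
  assumes "Digraph_Component.connected (with_proj B)" "p \<in> pverts B" "q \<in> pverts B"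
    and f: "f \<in> invariant_classes \<Lambda> G \<alpha> B \<pi> \<Psi> p"
  shows "transported_class G \<alpha> B \<pi> \<Psi> p f q \<in> fiber_K_ring \<Lambda> G \<alpha> \<pi> q"
proof -
  obtain \<gamma> where "\<gamma> \<in> paths B q p" using paths_nonempty[OF assms(1,3,2)] by blast
  with f show ?thesis
    by (simp add: transported_class_eq[OF assms] pullback_path_fiber_K_ring invariant_classes_def)
qed

text \<open>Any path \<gamma> from \<open>r\<close> to \<open>p\<close> extends to the path
  \<open>q # \<gamma>\<close>. Computing the class over \<open>r\<close> along the former and the
  class over \<open>q\<close> along the latter leaves exactly the pullback along the edge
  \<open>(q, r)\<close>.\<close>

lemma transported_class_edge:
  assumes "Digraph_Component.connected (with_proj B)" "p \<in> pverts B" "(q, r) \<in> parcs B"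
    and f: "f \<in> invariant_classes \<Lambda> G \<alpha> B \<pi> \<Psi> p"
  shows "transported_class G \<alpha> B \<pi> \<Psi> p f q
    = pullback G \<alpha> \<pi> q (lift_map G \<pi> q r, \<Psi> q r) (transported_class G \<alpha> B \<pi> \<Psi> p f r)"
proof -
  have v: "q \<in> pverts B" "r \<in> pverts B"
    using base.arc_fst_in_verts[OF assms(3)] base.arc_snd_in_verts[OF assms(3)] by auto
  obtain \<gamma> where \<gamma>: "\<gamma> \<in> paths B r p" using paths_nonempty[OF assms(1) v(2) assms(2)] by blast
  with f show ?thesis
    using transported_class_eq[OF assms(1,2) v(1) f paths_ConsI[OF assms(3) \<gamma>]]
      transported_class_eq[OF assms(1,2) v(2) f \<gamma>] pullback_path_Cons[OF assms(3) \<gamma>]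
    by (simp add: invariant_classes_def)
qed

section \<open>Horizontal and vertical edges of the total graph\<close>

lemma lift_map_edge:
  assumes e: "(u, v) \<in> parcs G" and h: "(\<pi> u, \<pi> v) \<in> parcs B"
  shows "lift_map G \<pi> (\<pi> u) (\<pi> v) u = v"
proof -
  have u: "u \<in> pverts G" using tot.arc_fst_in_verts[OF e] by simp
  \<comment> \<open>Two lifts of the same base edge at \<open>u\<close> have the same image under
    the differential of \<pi>, which is injective on the horizontal edges at
    \<open>u\<close>.\<close>
  have "v' = v" if "(u, v') \<in> parcs G" "\<pi> v' = \<pi> v" for v'
    using inj_onD[OF bij_betw_imp_inj_on[OF dproj_bij[OF u]], of "(u, v')" "(u, v)"] that e h
    by (simp add: horizontal_def)
  with e u show ?thesis by (auto simp: lift_map_def fiber_def intro!: the_equality)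
qed

lemma transported_class_horizontal:
  assumes "Digraph_Component.connected (with_proj B)" "p \<in> pverts B"
    and f: "f \<in> invariant_classes \<Lambda> G \<alpha> B \<pi> \<Psi> p"
    and e: "(u, v) \<in> parcs G" and h: "(\<pi> u, \<pi> v) \<in> parcs B"
  shows "\<exists>r \<in> rep_ring \<Lambda>. transported_class G \<alpha> B \<pi> \<Psi> p f (\<pi> u) u
    - transported_class G \<alpha> B \<pi> \<Psi> p f (\<pi> v) v = (1 - frag_of (\<alpha> (u, v))) * r"
proof -
  let ?f = "transported_class G \<alpha> B \<pi> \<Psi> p f"
  have uv: "u \<in> pverts (fiber G \<pi> (\<pi> u))" "v \<in> pverts (fiber G \<pi> (\<pi> v))"
    using tot.arc_fst_in_verts[OF e] tot.arc_snd_in_verts[OF e] by (auto simp: fiber_def)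
  have b: "\<pi> u \<in> pverts B" "\<pi> v \<in> pverts B"
    using base.arc_fst_in_verts[OF h] base.arc_snd_in_verts[OF h] by auto
  note K = transported_class_K_ring[OF assms(1,2) _ f]
  \<comment> \<open>The class over \<open>\<pi> u\<close> is the pullback of the class over
    \<open>\<pi> v\<close>, and the lift takes \<open>u\<close> to \<open>v\<close>; extending the
    transition map undoes the pullback.\<close>
  have "frag_extend (\<lambda>x. frag_of (\<Psi> (\<pi> u) (\<pi> v) x)) (?f (\<pi> u) u) = ?f (\<pi> v) v"
    using fiber_iso_extend_inverse[OF transition_iso[OF h] K[OF b(2)] uv(1)]
    by (simp add: transported_class_edge[OF assms(1,2) h f] lift_map_edge[OF e h])
  \<comment> \<open>The transition map shifts by multiples of the base weight, which equals
    \<open>\<alpha> (u, v)\<close> because the edge is horizontal.\<close>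
  moreover obtain m :: "'t \<Rightarrow> int"
    where "\<And>x. x \<in> fiber_span G \<alpha> \<pi> (\<pi> u) \<inter> \<Lambda> \<Longrightarrow> \<Psi> (\<pi> u) (\<pi> v) x = x + of_int (m x) *\<^sub>R \<alpha> (u, v)"
    using transition_shift[OF h] dproj_axial[of "(u, v)"] e h by (auto simp: horizontal_def)
  moreover have "Poly_Mapping.keys (?f (\<pi> u) u) \<subseteq> fiber_span G \<alpha> \<pi> (\<pi> u) \<inter> \<Lambda>"
    using fiber_K_ringD[OF K[OF b(1)] uv(1)] by blast
  ultimately show ?thesis
    using frag_extend_shift_dvd[OF weight_lattice_subgroup(1)[OF lattice] tot.axial_lattice[OF e]
        weight_lattice_subgroup(2)[OF lattice] weight_lattice_subgroup(3)[OF lattice] Int_lower2,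
        of "fiber_span G \<alpha> \<pi> (\<pi> u)" "\<Psi> (\<pi> u) (\<pi> v)" m "?f (\<pi> u) u"] by metis
qed

lemma transported_class_vertical:
  assumes "Digraph_Component.connected (with_proj B)" "p \<in> pverts B"
    and f: "f \<in> invariant_classes \<Lambda> G \<alpha> B \<pi> \<Psi> p"
    and e: "(u, v) \<in> parcs G" and vert: "\<pi> u = \<pi> v"
  shows "\<exists>r \<in> rep_ring \<Lambda>. transported_class G \<alpha> B \<pi> \<Psi> p f (\<pi> u) u
    - transported_class G \<alpha> B \<pi> \<Psi> p f (\<pi> v) v = (1 - frag_of (\<alpha> (u, v))) * r"
proof -
  have "\<pi> v \<in> pverts B" using tot.arc_snd_in_verts[OF e] proj_surj by auto
  note K = transported_class_K_ring[OF assms(1,2) this f]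
  have "(u, v) \<in> parcs (fiber G \<pi> (\<pi> v))" using e vert by (simp add: fiber_def)
  with K obtain r where "r \<in> rep_ring (fiber_span G \<alpha> \<pi> (\<pi> v) \<inter> \<Lambda>)"
    "transported_class G \<alpha> B \<pi> \<Psi> p f (\<pi> v) u - transported_class G \<alpha> B \<pi> \<Psi> p f (\<pi> v) v
      = (1 - frag_of (\<alpha> (u, v))) * r"
    unfolding fiber_K_ring_def K_ring_def by blast
  \<comment> \<open>The quotient found in the fiber ring serves unchanged, as that ring is contained
    in \<open>rep_ring \<Lambda>\<close>.\<close>
  then show ?thesis unfolding vert by (intro bexI[of _ r]) (auto simp: rep_ring_def)
qed

end

theorem proposition6p1:
  fixes \<Lambda> :: "'t::real_vector set"
    and G :: "'v pair_pre_digraph" and B :: "'b pair_pre_digraph"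
    and \<pi> :: "'v \<Rightarrow> 'b" and \<Psi> :: "'b \<Rightarrow> 'b \<Rightarrow> 't \<Rightarrow> 't"
    and p :: 'b and f c :: "'v \<Rightarrow> 't \<Rightarrow>\<^sub>0 int"
  assumes "gkm_fiber_bundle \<Lambda> G \<alpha> conn B \<alpha>\<^sub>B conn\<^sub>B \<pi> \<Psi>"
    and "Digraph_Component.connected (with_proj B)"
    and "p \<in> pverts B"
    and "f \<in> invariant_classes \<Lambda> G \<alpha> B \<pi> \<Psi> p"
    and "c = (\<lambda>q' \<in> pverts G. transported_class G \<alpha> B \<pi> \<Psi> p f (\<pi> q') q')"
  shows "(\<forall>q \<in> pverts B.
            transported_class G \<alpha> B \<pi> \<Psi> p f q \<in> fiber_K_ring \<Lambda> G \<alpha> \<pi> q \<and>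
            (\<forall>\<gamma> \<in> paths B q p.
               pullback G \<alpha> \<pi> q (path_iso G \<alpha> \<pi> \<Psi> \<gamma>) f = transported_class G \<alpha> B \<pi> \<Psi> p f q))
         \<and> c \<in> K_ring \<Lambda> G \<alpha>"
proof -
  interpret gkm_fiber_bundle \<Lambda> G \<alpha> conn B \<alpha>\<^sub>B conn\<^sub>B \<pi> \<Psi> by (fact assms(1))
  let ?f = "transported_class G \<alpha> B \<pi> \<Psi> p f"
  note K = transported_class_K_ring[OF assms(2,3) _ assms(4)]
  have "c \<in> K_ring \<Lambda> G \<alpha>"
    unfolding K_ring_def
  proof (intro CollectI conjI PiE_I ballI)
    fix u assume u: "u \<in> pverts G"
    have "\<pi> u \<in> pverts B" "u \<in> pverts (fiber G \<pi> (\<pi> u))"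
      using u proj_surj by (auto simp: fiber_def)
    with fiber_K_ringD(2)[OF K] u show "c u \<in> rep_ring \<Lambda>"
      by (simp add: assms(5) rep_ring_def)
  next
    fix e assume "e \<in> parcs G"
    then obtain u v where e: "e = (u, v)" "(u, v) \<in> parcs G" by (cases e) auto
    have "\<exists>r \<in> rep_ring \<Lambda>. ?f (\<pi> u) u - ?f (\<pi> v) v = (1 - frag_of (\<alpha> (u, v))) * r"
      using proj_edge[OF e(2)] transported_class_vertical[OF assms(2-4) e(2)]
        transported_class_horizontal[OF assms(2-4) e(2)] by blast
    with tot.arc_fst_in_verts[OF e(2)] tot.arc_snd_in_verts[OF e(2)]
    show "case e of (u, v) \<Rightarrow> \<exists>r \<in> rep_ring \<Lambda>. c u - c v = (1 - frag_of (\<alpha> (u, v))) * r"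
      by (simp add: e(1) assms(5))
  \<comment> \<open>What remains is extensionality: off the vertex set \<open>c\<close> is
    \<open>undefined\<close>.\<close>
  qed (simp add: assms(5))
  with K show ?thesis by (simp add: transported_class_eq[OF assms(2,3) _ assms(4)])
qed

end
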